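(* Let $N\ge 1$ and $N_u(0),N_d(0)\ge 0$ be integers with $N_u(0)+N_d(0)\le N$, let $0<d<1<u$ be real numbers, and let $(p(t))_{t\in\mathbb{N}_0}$ be the price process of the bulls-and-bears model with parameters $N,N_u(0),N_d(0),u,d$ and $p(0)>0$. Then for all integers $n\ge 1$ and $t\ge 0$, $$\begin{aligned}\mathbb{E}\left(\left(\log\frac{p(t)}{p(0)}\right)^n\right)=\sum_{\substack{n_u,n_d\in\mathbb{N}_0\\ n_u+n_d=n}}\frac{n!}{n_u!\,n_d!}(\log u)^{n_u}(\log d)^{n_d}\sum_{k_u=0}^{n_u}\frac{N_u(0)!}{(N_u(0)-k_u)!}\left\{\begin{matrix}n_u\\ k_u\end{matrix}\right\}\\ \cdot\sum_{k_d=0}^{n_d}\frac{N_d(0)!}{(N_d(0)-k_d)!}\left\{\begin{matrix}n_d\\ k_d\end{matrix}\right\}\sum_{j=0}^{k_u+k_d}(-1)^j\binom{k_u+k_d}{j}\left(1-\frac{j}{N}\right)^{t}.\end{aligned}$$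
   Context: $\mathbb{N}_0$ denotes the nonnegative integers. The bulls-and-bears model: there are $N$ investors. The process $(N_u(t),N_d(t),p(t))_{t\in\mathbb{N}_0}$ starts from the deterministic values $N_u(0),N_d(0),p(0)$. At each time $t$, conditionally on the whole history up to time $t$, exactly one of the following occurs: (bull chosen) with probability $N_u(t)/N$, $p(t+1)=u\,p(t)$, $N_u(t+1)=N_u(t)-1$, $N_d(t+1)=N_d(t)$; (bear chosen) with probability $N_d(t)/N$, $p(t+1)=d\,p(t)$, $N_d(t+1)=N_d(t)-1$, $N_u(t+1)=N_u(t)$; (inactive investor chosen) with probability $(N-N_u(t)-N_d(t))/N$, $p(t+1)=p(t)$, $N_u(t+1)=N_u(t)$, $N_d(t+1)=N_d(t)$. $\left\{\begin{matrix}n\\ k\end{matrix}\right\}$ is the Stirling number of the second kind: the number of partitions of a set of $n$ elements into $k$ nonempty sets (so $\left\{\begin{matrix}0\\ 0\end{matrix}\right\}=1$). For integers $a,l\ge 0$, $\frac{a!}{(a-l)!}$ denotes the falling factorial $a(a-1)\cdots(a-l+1)$, which is $0$ if $l>a$. Convention: $0^0=1$. *)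

theory Defs
  imports "HOL-Probability.Probability" "HOL-Combinatorics.Stirling"
begin

definition falling_factorial :: "nat \<Rightarrow> nat \<Rightarrow> real" where
  "falling_factorial a l = (\<Prod>i<l. real a - real i)"

text \<open>The sigma-algebra generated by the random variables \<open>X 0, \<dots>, X t\<close> (with values in \<open>S\<close>),
  i.e. the pullback of the product sigma-algebra under the path map up to time \<open>t\<close>.\<close>

definition history_algebra ::
    "'a measure \<Rightarrow> 'b measure \<Rightarrow> (nat \<Rightarrow> 'a \<Rightarrow> 'b) \<Rightarrow> nat \<Rightarrow> 'a measure" where
  "history_algebra M S X t =
     vimage_algebra (space M) (\<lambda>\<omega>. \<lambda>i\<in>{..t}. X i \<omega>) (PiM {..t} (\<lambda>_. S))"

text \<open>Conditional probabilities given the history are conditional expectations of indicators, hence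
  determined almost everywhere. The decrement of a count is written
  \<open>Nu (Suc t) \<omega> + 1 = Nu t \<omega>\<close>, as subtraction on \<open>nat\<close> truncates. The
  three events are pairwise disjoint and, for \<open>0 < N\<close>, their conditional probabilities add up to 1,
  so almost surely exactly one of them occurs.\<close>

locale bulls_and_bears = prob_space M
  for M :: "'a measure" +
  fixes N Nu0 Nd0 :: nat and u d p0 :: real
    and Nu Nd :: "nat \<Rightarrow> 'a \<Rightarrow> nat" and p :: "nat \<Rightarrow> 'a \<Rightarrow> real"
  fixes hist :: "nat \<Rightarrow> 'a measure"
  defines "hist \<equiv> history_algebra M (count_space UNIV \<Otimes>\<^sub>M count_space UNIV \<Otimes>\<^sub>M borel)
                    (\<lambda>i \<omega>. (Nu i \<omega>, Nd i \<omega>, p i \<omega>))"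
  assumes measurable_Nu: "\<And>t. Nu t \<in> measurable M (count_space UNIV)"
    and measurable_Nd: "\<And>t. Nd t \<in> measurable M (count_space UNIV)"
    and measurable_p: "\<And>t. p t \<in> borel_measurable M"
    and initial: "AE \<omega> in M. Nu 0 \<omega> = Nu0 \<and> Nd 0 \<omega> = Nd0 \<and> p 0 \<omega> = p0"
    and bull: "\<And>t. AE \<omega> in M.
      real_cond_exp M (hist t)
        (indicator {\<omega> \<in> space M. p (Suc t) \<omega> = u * p t \<omega> \<and>
                      Nu (Suc t) \<omega> + 1 = Nu t \<omega> \<and> Nd (Suc t) \<omega> = Nd t \<omega>}) \<omega>
      = real (Nu t \<omega>) / real N"
    and bear: "\<And>t. AE \<omega> in M.
      real_cond_exp M (hist t)
        (indicator {\<omega> \<in> space M. p (Suc t) \<omega> = d * p t \<omega> \<and>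
                      Nd (Suc t) \<omega> + 1 = Nd t \<omega> \<and> Nu (Suc t) \<omega> = Nu t \<omega>}) \<omega>
      = real (Nd t \<omega>) / real N"
    and inactive: "\<And>t. AE \<omega> in M.
      real_cond_exp M (hist t)
        (indicator {\<omega> \<in> space M. p (Suc t) \<omega> = p t \<omega> \<and>
                      Nu (Suc t) \<omega> = Nu t \<omega> \<and> Nd (Suc t) \<omega> = Nd t \<omega>}) \<omega>
      = (real N - real (Nu t \<omega>) - real (Nd t \<omega>)) / real N"

end

theory Submission
  imports Defs
begin

text \<open>Almost surely \<open>p t = p 0 * u ^ (Nu0 - Nu t) * d ^ (Nd0 - Nd t)\<close>, so the moments of the log-price
  are, by the binomial theorem and the expansion of powers into falling factorials, linear
  combinations of the joint factorial moments of the numbers \<open>Nu0 - Nu t\<close> and \<open>Nd0 - Nd t\<close> of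
  investors who have already acted. The falling factorials of the numbers \<open>Nu t\<close> and \<open>Nd t\<close> of
  those who have not are eigenfunctions of the transition operator: if \<open>x\<^sub>a\<close> denotes
  \<open>x (x - 1) \<dots> (x - a + 1)\<close>, then \<open>x (x - 1)\<^sub>a = (x - a) x\<^sub>a\<close>, which gives the eigenvalue
  \<open>1 - (a + b) / N\<close> for \<open>(Nu t)\<^sub>a (Nd t)\<^sub>b\<close>. The alternating sum over \<open>j\<close> arises from the
  Vandermonde-type expansion of \<open>(Nu0 - Nu t)\<^sub>a\<close> in the \<open>(Nu t)\<^sub>i\<close>.\<close>

section \<open>Falling factorials, Stirling numbers and alternating binomial sums\<close>

lemma falling_factorial_0 [simp]: "falling_factorial a 0 = 1"
  by (simp add: falling_factorial_def)

lemma falling_factorial_Suc: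
  "falling_factorial a (Suc l) = falling_factorial a l * (real a - real l)"
  by (simp add: falling_factorial_def)

lemma falling_factorial_eq_0 [simp]: "a < l \<Longrightarrow> falling_factorial a l = 0"
  by (auto simp: falling_factorial_def)

lemma falling_factorial_Suc_Suc:
  "falling_factorial (Suc a) (Suc l) = real (Suc a) * falling_factorial a l"
  unfolding falling_factorial_def prod.lessThan_Suc_shift by simp

text \<open>Discrete analogue of differentiating a power. For \<open>l = 0\<close> the truncated
  \<open>l - 1\<close> is harmless because of the factor \<open>real l\<close>.\<close>

lemma falling_factorial_Suc_diff:
  "falling_factorial (Suc a) l = falling_factorial a l + real l * falling_factorial a (l - 1)"
proof (cases l)
  case (Suc k)
  have "falling_factorial (Suc a) (Suc k) = real (Suc a) * falling_factorial a k"
    by (rule falling_factorial_Suc_Suc)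
  also have "\<dots> = falling_factorial a (Suc k) + real (Suc k) * falling_factorial a k"
    by (simp add: falling_factorial_Suc algebra_simps)
  finally show ?thesis
    by (simp add: Suc)
qed simp

text \<open>The source of the eigenvalues: for positive \<open>m\<close> both sides equal
  \<open>falling_factorial m (Suc a)\<close>. At \<open>m = 0\<close>, where \<open>m - 1\<close>
  truncates, both sides vanish.\<close>

lemma mult_falling_factorial_diff_1:
  "real m * falling_factorial (m - 1) a = (real m - real a) * falling_factorial m a"
proof (cases m)
  case (Suc k)
  then have "real m * falling_factorial (m - 1) a = falling_factorial m (Suc a)"
    by (simp add: falling_factorial_Suc_Suc)
  then show ?thesis
    by (simp add: falling_factorial_Suc)
qed (cases a; simp)

lemma falling_factorial_add:
  "falling_factorial a i * falling_factorial (a - i) l = falling_factorial a (i + l)"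
proof (cases "i \<le> a")
  case True
  then show ?thesis
    by (induction l) (simp_all add: falling_factorial_Suc of_nat_diff flip: mult.assoc)
qed simp

text \<open>Multiplying by \<open>x\<close> sends the \<open>k\<close>-th falling factorial to the
  next one plus \<open>k\<close> times itself, which is the recurrence of the Stirling
  numbers.\<close>

lemma power_eq_sum_Stirling:
  "real x ^ n = (\<Sum>k\<le>n. real (Stirling n k) * falling_factorial x k)"
proof (induction n)
  case (Suc n)
  let ?S = "\<lambda>n k. real (Stirling n k)" and ?f = "falling_factorial x"
  have "real x ^ Suc n = (\<Sum>k\<le>n. ?S n k * (real x * ?f k))"
    by (simp add: Suc sum_distrib_left mult_ac)
  also have "\<dots> = (\<Sum>k\<le>n. ?S n k * ?f (Suc k)) + (\<Sum>k\<le>n. real k * ?S n k * ?f k)"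
    by (simp add: falling_factorial_Suc sum.distrib[symmetric] algebra_simps)
  \<comment> \<open>The added top term is zero since \<open>Stirling n (Suc n) = 0\<close>; the
    bottom term, dropped next, has the factor \<open>k = 0\<close>.\<close>
  also have "(\<Sum>k\<le>n. real k * ?S n k * ?f k) = (\<Sum>k\<le>Suc n. real k * ?S n k * ?f k)"
    by simp
  also have "\<dots> = (\<Sum>k\<le>n. real (Suc k) * ?S n (Suc k) * ?f (Suc k))"
    by (subst sum.atMost_Suc_shift) simp
  also have "(\<Sum>k\<le>n. ?S n k * ?f (Suc k)) + \<dots> = (\<Sum>k\<le>n. ?S (Suc n) (Suc k) * ?f (Suc k))"
    by (simp add: sum.distrib[symmetric] algebra_simps)
  also have "\<dots> = (\<Sum>k\<le>Suc n. ?S (Suc n) k * ?f k)"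
    by (subst sum.atMost_Suc_shift) simp
  finally show ?case .
qed simp

text \<open>Inclusion-exclusion: the left side counts injective \<open>k\<close>-tuples from an
  \<open>a\<close>-set that avoid a given \<open>m\<close>-subset, and \<open>i\<close> is the
  number of positions prescribed to lie in that subset. The proof is an induction on
  \<open>m\<close> instead, comparing first differences in \<open>m\<close> of both sides; since it
  passes to \<open>a - 1\<close> and \<open>k - 1\<close>, both stay arbitrary.\<close>

lemma falling_factorial_complement:
  assumes "m \<le> a"
  shows "falling_factorial (a - m) k =
    (\<Sum>i\<le>k. (-1) ^ i * real (k choose i) * falling_factorial m i * falling_factorial (a - i) (k - i))"
  using assms
proof (induction m arbitrary: a k)
  case 0
  have "(\<Sum>i\<le>k. (-1) ^ i * real (k choose i) * falling_factorial 0 i * falling_factorial (a - i) (k - i))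
      = (\<Sum>i\<in>{0}. (-1) ^ i * real (k choose i) * falling_factorial 0 i * falling_factorial (a - i) (k - i))"
    by (rule sum.mono_neutral_right) auto
  then show ?case by simp
next
  case (Suc m)
  show ?case
  proof (cases k)
    case (Suc l)
    let ?f = falling_factorial
    have am: "a - m = Suc (a - Suc m)"
      using Suc.prems by simp
    have "?f (a - Suc m) (Suc l) = ?f (a - m) (Suc l) - real (Suc l) * ?f (a - 1 - m) l"
      unfolding am falling_factorial_Suc_diff by simp
    also have "real (Suc l) * ?f (a - 1 - m) l
        = real (Suc l) * (\<Sum>i\<le>l. (-1) ^ i * real (l choose i) * ?f m i * ?f (a - 1 - i) (l - i))"
      using Suc.prems by (subst Suc.IH) auto
    \<comment> \<open>Absorption,
      \<open>(l + 1) (l choose i) = (i + 1) (l + 1 choose i + 1)\<close>, followed by an index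
      shift, gives this sum the binomial weights of the expansion of
      \<open>?f (a - m) (Suc l)\<close>, so that the two merge termwise.\<close>
    also have "\<dots> = - (\<Sum>i\<le>l. (-1) ^ Suc i * real (Suc i * (Suc l choose Suc i)) * ?f m i * ?f (a - Suc i) (l - i))"
      unfolding Suc_times_binomial sum_distrib_left sum_negf[symmetric]
      by (intro sum.cong refl) (simp add: algebra_simps)
    also have "\<dots> = - (\<Sum>i\<le>Suc l. (-1) ^ i * real (i * (Suc l choose i)) * ?f m (i - 1) * ?f (a - i) (Suc l - i))"
      by (subst sum.atMost_Suc_shift) simp
    also have "?f (a - m) (Suc l) = (\<Sum>i\<le>Suc l. (-1) ^ i * real (Suc l choose i) * ?f m i * ?f (a - i) (Suc l - i))"
      using Suc.prems by (intro Suc.IH) simp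
    finally show ?thesis
      unfolding Suc falling_factorial_Suc_diff[of m]
      by (simp add: sum.distrib[symmetric] algebra_simps del: sum.atMost_Suc)
  qed simp
qed

text \<open>With the shift operator \<open>E\<close>, the alternating sum is
  \<open>(1 - E)^k\<close> applied to \<open>h\<close> and evaluated at 0; this peels off one factor
  \<open>1 - E\<close> by Pascal's rule.\<close>

lemma alternating_sum_choose_Suc:
  fixes h :: "nat \<Rightarrow> real"
  shows "(\<Sum>i\<le>Suc k. (-1) ^ i * real (Suc k choose i) * h i) =
    (\<Sum>i\<le>k. (-1) ^ i * real (k choose i) * (h i - h (Suc i)))"
proof -
  have "(\<Sum>i\<le>Suc k. (-1) ^ i * real (Suc k choose i) * h i) =
      h 0 + (\<Sum>i\<le>k. (-1) ^ Suc i * real (k choose Suc i) * h (Suc i))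
       + (\<Sum>i\<le>k. (-1) ^ Suc i * real (k choose i) * h (Suc i))"
    by (subst sum.atMost_Suc_shift) (simp add: sum.distrib[symmetric] algebra_simps)
  also have "h 0 + (\<Sum>i\<le>k. (-1) ^ Suc i * real (k choose Suc i) * h (Suc i))
      = (\<Sum>i\<le>Suc k. (-1) ^ i * real (k choose i) * h i)"
    by (subst sum.atMost_Suc_shift) simp
  also have "\<dots> = (\<Sum>i\<le>k. (-1) ^ i * real (k choose i) * h i)"
    by simp
  finally show ?thesis
    by (simp add: sum_negf right_diff_distrib sum_subtractf)
qed

text \<open>In the same notation, \<open>(1 - E)^a (1 - E)^b = (1 - E)^(a + b)\<close>. The
  induction on \<open>a\<close> replaces \<open>h\<close> by its difference, hence \<open>h\<close>
  is arbitrary.\<close>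

lemma alternating_sum_choose_add:
  fixes h :: "nat \<Rightarrow> real"
  shows "(\<Sum>i\<le>a. \<Sum>j\<le>b. (-1) ^ i * (-1) ^ j * real (a choose i) * real (b choose j) * h (i + j)) =
    (\<Sum>j\<le>a + b. (-1) ^ j * real ((a + b) choose j) * h j)"
proof (induction a arbitrary: h)
  case (Suc a)
  let ?D = "\<lambda>h i. \<Sum>j\<le>b. (-1) ^ j * real (b choose j) * (h (i + j) :: real)"
  have D: "(\<Sum>i\<le>a. \<Sum>j\<le>b. (-1) ^ i * (-1) ^ j * real (a choose i) * real (b choose j) * h (i + j)) =
      (\<Sum>i\<le>a. (-1) ^ i * real (a choose i) * ?D h i)" for a h
    by (simp add: sum_distrib_left mult_ac)
  have "(\<Sum>i\<le>Suc a. (-1) ^ i * real (Suc a choose i) * ?D h i) =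
      (\<Sum>i\<le>a. (-1) ^ i * real (a choose i) * ?D (\<lambda>k. h k - h (Suc k)) i)"
    unfolding alternating_sum_choose_Suc
    by (simp add: sum_subtractf[symmetric] algebra_simps)
  also have "\<dots> = (\<Sum>j\<le>a + b. (-1) ^ j * real ((a + b) choose j) * (h j - h (Suc j)))"
    using Suc[of "\<lambda>k. h k - h (Suc k)"] D[of a "\<lambda>k. h k - h (Suc k)"] by simp
  also have "\<dots> = (\<Sum>j\<le>Suc a + b. (-1) ^ j * real ((Suc a + b) choose j) * h j)"
    using alternating_sum_choose_Suc[of "a + b" h] by simp
  finally show ?case
    unfolding D .
qed simp


section \<open>Conditional probabilities under the expectation, and the history algebra\<close>

context prob_space
begin

text \<open>An \<open>F\<close>-measurable factor can be pulled out of the conditional expectation.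
  Integrability of \<open>g * q\<close> is inherited from the conditional expectation, so it is
  available before any bound on \<open>q\<close> is known.\<close>

lemma
  assumes F: "subalgebra M F" and A [measurable]: "A \<in> events"
    and g: "g \<in> borel_measurable F" and bounded: "AE \<omega> in M. \<bar>g \<omega>\<bar> \<le> C"
    and q [measurable]: "q \<in> borel_measurable M"
    and cond: "AE \<omega> in M. real_cond_exp M F (indicator A) \<omega> = q \<omega>"
  shows integrable_mult_indicator_of_bounded: "integrable M (\<lambda>\<omega>. g \<omega> * indicator A \<omega>)"
    and integrable_mult_cond_prob: "integrable M (\<lambda>\<omega>. g \<omega> * q \<omega>)"
    and expectation_mult_cond_prob:
      "expectation (\<lambda>\<omega>. g \<omega> * indicator A \<omega>) = expectation (\<lambda>\<omega>. g \<omega> * q \<omega>)"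
proof -
  interpret finite_measure_subalgebra M F
    by standard (rule F)
  have [measurable]: "g \<in> borel_measurable M"
    by (rule measurable_from_subalg[OF F g])
  have C: "AE \<omega> in M. norm (g \<omega> * indicator A \<omega>) \<le> C"
    using bounded by eventually_elim (auto simp: indicator_def split: if_splits)
  show int: "integrable M (\<lambda>\<omega>. g \<omega> * indicator A \<omega>)"
    by (rule integrable_const_bound[OF C]) simp
  have eq: "AE \<omega> in M. g \<omega> * real_cond_exp M F (indicator A) \<omega> = g \<omega> * q \<omega>"
    using cond by eventually_elim simp
  note * = real_cond_exp_intg[OF int g]
  show "integrable M (\<lambda>\<omega>. g \<omega> * q \<omega>)"
    by (rule integrable_cong_AE_imp[OF *(1)]) (use eq in auto)
  have "expectation (\<lambda>\<omega>. g \<omega> * q \<omega>) = expectation (\<lambda>\<omega>. g \<omega> * real_cond_exp M F (indicator A) \<omega>)"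
    by (rule integral_cong_AE) (use eq in auto)
  then show "expectation (\<lambda>\<omega>. g \<omega> * indicator A \<omega>) = expectation (\<lambda>\<omega>. g \<omega> * q \<omega>)"
    using * by simp
qed

end

lemma subalgebra_history_algebra:
  assumes "\<And>i. X i \<in> measurable M S"
  shows "subalgebra M (history_algebra M S X t)"
  unfolding subalgebra_def history_algebra_def
proof
  show "sets (vimage_algebra (space M) (\<lambda>\<omega>. \<lambda>i\<in>{..t}. X i \<omega>) (PiM {..t} (\<lambda>_. S))) \<subseteq> sets M"
    using assms by (intro sets_image_in_sets measurable_restrict) auto
qed simp

lemma measurable_history_algebra:
  assumes "\<And>i. X i \<in> measurable M S"
  shows "X t \<in> measurable (history_algebra M S X t) S"
proof -
  have X: "(\<lambda>\<omega>. \<lambda>i\<in>{..t}. X i \<omega>) \<in> measurable M (PiM {..t} (\<lambda>_. S))"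
    using assms by (rule measurable_restrict)
  have "(\<lambda>\<omega>. \<lambda>i\<in>{..t}. X i \<omega>) \<in> measurable (history_algebra M S X t) (PiM {..t} (\<lambda>_. S))"
    unfolding history_algebra_def
    by (intro measurable_vimage_algebra1 funcsetI) (rule measurable_space[OF X])
  from measurable_compose[OF this measurable_component_singleton[of t]]
  show ?thesis by simp
qed

section \<open>The three transitions, the price formula and the transition operator\<close>

context bulls_and_bears
begin

declare measurable_Nu [measurable] measurable_Nd [measurable] measurable_p [measurable]

text \<open>The three events repeat the sets in the locale assumptions verbatim, so that these
  assumptions can be folded.\<close>

definition bull_event :: "nat \<Rightarrow> 'a set" where
  "bull_event t = {\<omega> \<in> space M. p (Suc t) \<omega> = u * p t \<omega> \<and>
     Nu (Suc t) \<omega> + 1 = Nu t \<omega> \<and> Nd (Suc t) \<omega> = Nd t \<omega>}"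

definition bear_event :: "nat \<Rightarrow> 'a set" where
  "bear_event t = {\<omega> \<in> space M. p (Suc t) \<omega> = d * p t \<omega> \<and>
     Nd (Suc t) \<omega> + 1 = Nd t \<omega> \<and> Nu (Suc t) \<omega> = Nu t \<omega>}"

definition inactive_event :: "nat \<Rightarrow> 'a set" where
  "inactive_event t = {\<omega> \<in> space M. p (Suc t) \<omega> = p t \<omega> \<and>
     Nu (Suc t) \<omega> = Nu t \<omega> \<and> Nd (Suc t) \<omega> = Nd t \<omega>}"

lemmas event_defs = bull_event_def bear_event_def inactive_event_def

lemma events_measurable [measurable]:
  "bull_event t \<in> events" "bear_event t \<in> events" "inactive_event t \<in> events"
proof -
  \<comment> \<open>Equality of counts is tested after embedding them into the reals, where
    \<open>borel_measurable_eq\<close> applies.\<close>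
  have eq: "Measurable.pred M (\<lambda>\<omega>. f \<omega> = g \<omega>)"
    if fg: "f \<in> measurable M (count_space UNIV)" "g \<in> measurable M (count_space UNIV)"
    for f g :: "'a \<Rightarrow> nat"
  proof -
    have "(\<lambda>\<omega>. real (f \<omega>)) \<in> borel_measurable M" "(\<lambda>\<omega>. real (g \<omega>)) \<in> borel_measurable M"
      by (auto intro: measurable_compose[OF fg(1)] measurable_compose[OF fg(2)])
    from borel_measurable_eq[OF this] show ?thesis
      by (simp add: pred_def)
  qed
  have [measurable]: "Measurable.pred M (\<lambda>\<omega>. Nu (Suc t) \<omega> + 1 = Nu t \<omega>)"
    "Measurable.pred M (\<lambda>\<omega>. Nd (Suc t) \<omega> + 1 = Nd t \<omega>)"
    "Measurable.pred M (\<lambda>\<omega>. Nu (Suc t) \<omega> = Nu t \<omega>)"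
    "Measurable.pred M (\<lambda>\<omega>. Nd (Suc t) \<omega> = Nd t \<omega>)"
    by (intro eq; measurable)+
  show "bull_event t \<in> events" "bear_event t \<in> events" "inactive_event t \<in> events"
    unfolding event_defs by measurable
qed

lemma subalgebra_hist: "subalgebra M (hist t)"
  unfolding hist_def by (rule subalgebra_history_algebra) measurable

lemma borel_measurable_hist:
  "(\<lambda>\<omega>. f (Nu t \<omega>) (Nd t \<omega>) :: real) \<in> borel_measurable (hist t)"
proof -
  let ?S = "count_space UNIV \<Otimes>\<^sub>M count_space UNIV \<Otimes>\<^sub>M borel :: (nat \<times> nat \<times> real) measure"
  have X: "(\<lambda>\<omega>. (Nu t \<omega>, Nd t \<omega>, p t \<omega>)) \<in> measurable (hist t) ?S"
    unfolding hist_def by (rule measurable_history_algebra) measurable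
  have f: "(\<lambda>x. f (fst x) (fst (snd x))) \<in> borel_measurable ?S"
    by measurable
  show ?thesis
    using measurable_compose[OF X f] by simp
qed

text \<open>Taking expectations with \<open>g = 1\<close>, the probabilities of the three disjoint
  events add up to the expectation of the constant 1. Splitting that expectation requires the counts
  to be integrable; their almost sure bounds are derived from this lemma later, so integrability
  comes from \<open>integrable_mult_cond_prob\<close>.\<close>

lemma AE_some_event:
  assumes "0 < N"
  shows "AE \<omega> in M. \<omega> \<in> bull_event t \<or> \<omega> \<in> bear_event t \<or> \<omega> \<in> inactive_event t"
proof -
  note * = expectation_mult_cond_prob[where g = "\<lambda>_. 1" and C = 1, OF subalgebra_hist]
    integrable_mult_cond_prob[where g = "\<lambda>_. 1" and C = 1, OF subalgebra_hist]
  let ?q = "\<lambda>\<omega>. (real N - real (Nu t \<omega>) - real (Nd t \<omega>)) / real N"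
  have U: "prob (bull_event t) = expectation (\<lambda>\<omega>. real (Nu t \<omega>) / real N)"
      "integrable M (\<lambda>\<omega>. real (Nu t \<omega>) / real N)"
    using *[OF _ _ _ _ bull[folded bull_event_def]] by simp_all
  have D: "prob (bear_event t) = expectation (\<lambda>\<omega>. real (Nd t \<omega>) / real N)"
      "integrable M (\<lambda>\<omega>. real (Nd t \<omega>) / real N)"
    using *[OF _ _ _ _ bear[folded bear_event_def]] by simp_all
  have I: "prob (inactive_event t) = expectation ?q" "integrable M ?q"
    using *[OF _ _ _ _ inactive[folded inactive_event_def]] by simp_all
  have disjoint: "bull_event t \<inter> bear_event t = {}"
      "(bull_event t \<union> bear_event t) \<inter> inactive_event t = {}"
    by (auto simp: event_defs)
  have "prob (bull_event t \<union> bear_event t \<union> inactive_event t) =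
      prob (bull_event t) + prob (bear_event t) + prob (inactive_event t)"
    using finite_measure_Union[OF _ _ disjoint(1)] finite_measure_Union[OF _ _ disjoint(2)] by simp
  also have "\<dots> = expectation (\<lambda>\<omega>. real (Nu t \<omega>) / real N + real (Nd t \<omega>) / real N + ?q \<omega>)"
    unfolding U(1) D(1) I(1) using U(2) D(2) I(2) by simp
  also have "\<dots> = 1"
    using assms by (simp add: field_simps prob_space)
  finally show ?thesis
    by (subst (asm) prob_eq_1) auto
qed

text \<open>The bounds on the counts are part of the invariant because the exponents are truncated
  differences: only below the initial count does a decrement raise the exponent by one.\<close>

lemma AE_price_eq:
  assumes "0 < N"
  shows "AE \<omega> in M. Nu t \<omega> \<le> Nu0 \<and> Nd t \<omega> \<le> Nd0 \<and>
    p t \<omega> = p0 * u ^ (Nu0 - Nu t \<omega>) * d ^ (Nd0 - Nd t \<omega>)"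
proof (induction t)
  case 0
  show ?case
    using initial by eventually_elim simp
next
  case (Suc t)
  have pow: "x ^ (m - k) = x * x ^ (m - Suc k)" if "Suc k \<le> m" for x :: real and m k :: nat
    using that by (metis Suc_diff_le diff_Suc_Suc power_Suc)
  from Suc AE_some_event[OF assms, of t] show ?case
  proof eventually_elim
    case (elim \<omega>)
    from elim(2) consider "\<omega> \<in> bull_event t" | "\<omega> \<in> bear_event t" | "\<omega> \<in> inactive_event t"
      by blast
    then show ?case
    proof cases
      case 1
      then have "Nu t \<omega> = Suc (Nu (Suc t) \<omega>)" "Nd (Suc t) \<omega> = Nd t \<omega>" "p (Suc t) \<omega> = u * p t \<omega>"
        by (auto simp: bull_event_def)
      with elim(1) show ?thesis
        by (simp add: pow[of "Nu (Suc t) \<omega>" Nu0])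
    next
      case 2
      then have "Nd t \<omega> = Suc (Nd (Suc t) \<omega>)" "Nu (Suc t) \<omega> = Nu t \<omega>" "p (Suc t) \<omega> = d * p t \<omega>"
        by (auto simp: bear_event_def)
      with elim(1) show ?thesis
        by (simp add: pow[of "Nd (Suc t) \<omega>" Nd0])
    next
      case 3
      with elim(1) show ?thesis
        by (simp add: inactive_event_def)
    qed
  qed
qed

text \<open>Almost surely the state lies in a finite grid, so any function of it is bounded by the
  sum of its absolute values there.\<close>

lemma AE_state_bounded:
  fixes f :: "nat \<Rightarrow> nat \<Rightarrow> real"
  assumes "0 < N"
  shows "AE \<omega> in M. \<bar>f (Nu t \<omega>) (Nd t \<omega>)\<bar> \<le> (\<Sum>(a, b) \<in> {..Nu0} \<times> {..Nd0}. \<bar>f a b\<bar>)"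
  using AE_price_eq[OF assms, of t]
proof eventually_elim
  case (elim \<omega>)
  then have "(Nu t \<omega>, Nd t \<omega>) \<in> {..Nu0} \<times> {..Nd0}"
    by simp
  from member_le_sum[OF this, of "\<lambda>(a, b). \<bar>f a b\<bar>"] show ?case
    by (auto simp: case_prod_beta)
qed

lemma integrable_state:
  fixes f :: "nat \<Rightarrow> nat \<Rightarrow> real"
  assumes "0 < N"
  shows "integrable M (\<lambda>\<omega>. f (Nu t \<omega>) (Nd t \<omega>))"
  using AE_state_bounded[OF assms, of f t] by (intro integrable_const_bound) auto

text \<open>On each event the next state is a function of the current one, so the new value splits
  into three history-measurable factors times indicators, which are then replaced by the conditional
  probabilities. The truncated \<open>Nu t \<omega> - 1\<close> is exact on the bull event, where
  \<open>Nu t \<omega>\<close> is positive; likewise for bears.\<close>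

lemma expectation_Suc:
  fixes f :: "nat \<Rightarrow> nat \<Rightarrow> real"
  assumes "0 < N"
  shows "expectation (\<lambda>\<omega>. f (Nu (Suc t) \<omega>) (Nd (Suc t) \<omega>)) =
    expectation (\<lambda>\<omega>. f (Nu t \<omega> - 1) (Nd t \<omega>) * (real (Nu t \<omega>) / real N)
      + f (Nu t \<omega>) (Nd t \<omega> - 1) * (real (Nd t \<omega>) / real N)
      + f (Nu t \<omega>) (Nd t \<omega>) * ((real N - real (Nu t \<omega>) - real (Nd t \<omega>)) / real N))"
    (is "_ = expectation (\<lambda>\<omega>. ?U \<omega> * ?qU \<omega> + ?D \<omega> * ?qD \<omega> + ?I \<omega> * ?qI \<omega>)")
proof -
  note facts = integrable_mult_indicator_of_bounded integrable_mult_cond_prob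
    expectation_mult_cond_prob
  note U = facts[OF subalgebra_hist _ borel_measurable_hist
      AE_state_bounded[OF assms, of "\<lambda>a b. f (a - 1) b" t] _ bull[folded bull_event_def]]
  note D = facts[OF subalgebra_hist _ borel_measurable_hist
      AE_state_bounded[OF assms, of "\<lambda>a b. f a (b - 1)" t] _ bear[folded bear_event_def]]
  note I = facts[OF subalgebra_hist _ borel_measurable_hist
      AE_state_bounded[OF assms, of f t] _ inactive[folded inactive_event_def]]
  have "AE \<omega> in M. f (Nu (Suc t) \<omega>) (Nd (Suc t) \<omega>) =
      ?U \<omega> * indicator (bull_event t) \<omega> + ?D \<omega> * indicator (bear_event t) \<omega>
      + ?I \<omega> * indicator (inactive_event t) \<omega>"
    using AE_some_event[OF assms, of t]
  proof eventually_elim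
    case (elim \<omega>)
    then consider "\<omega> \<in> bull_event t" | "\<omega> \<in> bear_event t" | "\<omega> \<in> inactive_event t"
      by blast
    then show ?case
    proof cases
      case 1
      then have "\<omega> \<notin> bear_event t" "\<omega> \<notin> inactive_event t" "Nu t \<omega> - 1 = Nu (Suc t) \<omega>"
          "Nd (Suc t) \<omega> = Nd t \<omega>"
        by (auto simp: event_defs)
      with 1 show ?thesis by simp
    next
      case 2
      then have "\<omega> \<notin> bull_event t" "\<omega> \<notin> inactive_event t" "Nd t \<omega> - 1 = Nd (Suc t) \<omega>"
          "Nu (Suc t) \<omega> = Nu t \<omega>"
        by (auto simp: event_defs)
      with 2 show ?thesis by simp
    next
      case 3
      then have "\<omega> \<notin> bull_event t" "\<omega> \<notin> bear_event t" "Nu (Suc t) \<omega> = Nu t \<omega>"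
          "Nd (Suc t) \<omega> = Nd t \<omega>"
        by (auto simp: event_defs)
      with 3 show ?thesis by simp
    qed
  qed
  then have "expectation (\<lambda>\<omega>. f (Nu (Suc t) \<omega>) (Nd (Suc t) \<omega>)) =
      expectation (\<lambda>\<omega>. ?U \<omega> * indicator (bull_event t) \<omega> + ?D \<omega> * indicator (bear_event t) \<omega>
        + ?I \<omega> * indicator (inactive_event t) \<omega>)"
    by (intro integral_cong_AE) auto
  also have "\<dots> = expectation (\<lambda>\<omega>. ?U \<omega> * ?qU \<omega>) + expectation (\<lambda>\<omega>. ?D \<omega> * ?qD \<omega>)
      + expectation (\<lambda>\<omega>. ?I \<omega> * ?qI \<omega>)"
    using U D I by simp
  also have "\<dots> = expectation (\<lambda>\<omega>. ?U \<omega> * ?qU \<omega> + ?D \<omega> * ?qD \<omega> + ?I \<omega> * ?qI \<omega>)"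
    using U(2) D(2) I(2) by simp
  finally show ?thesis .
qed

section \<open>Joint moments of the remaining and of the departed investors\<close>

lemma expectation_falling_factorial:
  assumes "0 < N"
  shows "expectation (\<lambda>\<omega>. falling_factorial (Nu t \<omega>) a * falling_factorial (Nd t \<omega>) b) =
    falling_factorial Nu0 a * falling_factorial Nd0 b * (1 - real (a + b) / real N) ^ t"
proof (induction t)
  case 0
  have "expectation (\<lambda>\<omega>. falling_factorial (Nu 0 \<omega>) a * falling_factorial (Nd 0 \<omega>) b) =
      expectation (\<lambda>\<omega>. falling_factorial Nu0 a * falling_factorial Nd0 b)"
  proof (rule integral_cong_AE)
    show "AE \<omega> in M. falling_factorial (Nu 0 \<omega>) a * falling_factorial (Nd 0 \<omega>) b =
        falling_factorial Nu0 a * falling_factorial Nd0 b"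
      using initial by eventually_elim simp
  qed measurable
  then show ?case
    by (simp add: prob_space)
next
  case (Suc t)
  let ?f = falling_factorial and ?c = "1 - real (a + b) / real N"
  \<comment> \<open>The eigenfunction equation: the first two terms contribute
    \<open>(x - a + y - b) / N\<close>, and the inactive term cancels \<open>x + y\<close>.\<close>
  have step: "?f (x - 1) a * ?f y b * (real x / real N) + ?f x a * ?f (y - 1) b * (real y / real N)
      + ?f x a * ?f y b * ((real N - real x - real y) / real N) = ?c * (?f x a * ?f y b)" for x y
  proof -
    have "?f (x - 1) a * ?f y b * (real x / real N) + ?f x a * ?f (y - 1) b * (real y / real N)
        = ((real x * ?f (x - 1) a) * ?f y b + ?f x a * (real y * ?f (y - 1) b)) / real N"
      by (simp add: add_divide_distrib mult_ac)
    also have "\<dots> = (real x - real a + real y - real b) / real N * (?f x a * ?f y b)"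
      unfolding mult_falling_factorial_diff_1 by (simp add: algebra_simps)
    finally have L: "?f (x - 1) a * ?f y b * (real x / real N) + ?f x a * ?f (y - 1) b * (real y / real N)
        = (real x - real a + real y - real b) / real N * (?f x a * ?f y b)" .
    show ?thesis
      unfolding L using assms by (simp add: field_simps)
  qed
  have "expectation (\<lambda>\<omega>. ?f (Nu (Suc t) \<omega>) a * ?f (Nd (Suc t) \<omega>) b) =
      expectation (\<lambda>\<omega>. ?c * (?f (Nu t \<omega>) a * ?f (Nd t \<omega>) b))"
    unfolding expectation_Suc[OF assms, of "\<lambda>x y. ?f x a * ?f y b"] step ..
  then show ?case
    by (simp add: Suc)
qed

lemma expectation_falling_factorial_departed:
  assumes "0 < N"
  shows "expectation (\<lambda>\<omega>. falling_factorial (Nu0 - Nu t \<omega>) a * falling_factorial (Nd0 - Nd t \<omega>) b) =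
    falling_factorial Nu0 a * falling_factorial Nd0 b *
      (\<Sum>j\<le>a + b. (-1) ^ j * real ((a + b) choose j) * (1 - real j / real N) ^ t)"
proof -
  let ?f = falling_factorial and ?h = "\<lambda>j. (1 - real j / real N) ^ t"
  let ?c = "\<lambda>i j. ((-1) ^ i * real (a choose i) * ?f (Nu0 - i) (a - i)) *
      ((-1) ^ j * real (b choose j) * ?f (Nd0 - j) (b - j))"
  have "expectation (\<lambda>\<omega>. ?f (Nu0 - Nu t \<omega>) a * ?f (Nd0 - Nd t \<omega>) b) =
      expectation (\<lambda>\<omega>. \<Sum>i\<le>a. \<Sum>j\<le>b. ?c i j * (?f (Nu t \<omega>) i * ?f (Nd t \<omega>) j))"
  proof (rule integral_cong_AE)
    show "AE \<omega> in M. ?f (Nu0 - Nu t \<omega>) a * ?f (Nd0 - Nd t \<omega>) b =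
        (\<Sum>i\<le>a. \<Sum>j\<le>b. ?c i j * (?f (Nu t \<omega>) i * ?f (Nd t \<omega>) j))"
      using AE_price_eq[OF assms, of t]
      by eventually_elim (simp add: falling_factorial_complement sum_product mult_ac)
  qed measurable
  also have "\<dots> = (\<Sum>i\<le>a. \<Sum>j\<le>b. ?c i j * expectation (\<lambda>\<omega>. ?f (Nu t \<omega>) i * ?f (Nd t \<omega>) j))"
    using integrable_state[OF assms, of "\<lambda>x y. ?f x _ * ?f y _" t]
    by (simp add: Bochner_Integration.integral_sum Bochner_Integration.integrable_sum)
  also have "\<dots> = (\<Sum>i\<le>a. \<Sum>j\<le>b. (?f Nu0 i * ?f (Nu0 - i) (a - i)) * (?f Nd0 j * ?f (Nd0 - j) (b - j)) *
      ((-1) ^ i * (-1) ^ j * real (a choose i) * real (b choose j) * ?h (i + j)))"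
    unfolding expectation_falling_factorial[OF assms] by (simp add: mult_ac)
  \<comment> \<open>By \<open>falling_factorial_add\<close> the initial counts no longer depend on
    \<open>i\<close> and \<open>j\<close>. What remains depends on the eigenvalue only through
    \<open>i + j\<close>, so the double alternating sum collapses to a single one.\<close>
  also have "\<dots> = (\<Sum>i\<le>a. \<Sum>j\<le>b. ?f Nu0 a * ?f Nd0 b *
      ((-1) ^ i * (-1) ^ j * real (a choose i) * real (b choose j) * ?h (i + j)))"
    unfolding falling_factorial_add by (intro sum.cong refl) simp
  also have "\<dots> = ?f Nu0 a * ?f Nd0 b * (\<Sum>j\<le>a + b. (-1) ^ j * real ((a + b) choose j) * ?h j)"
    by (simp only: sum_distrib_left[symmetric] alternating_sum_choose_add[where h = ?h])
  finally show ?thesis .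
qed

lemma expectation_power_departed:
  assumes "0 < N"
  shows "expectation (\<lambda>\<omega>. real (Nu0 - Nu t \<omega>) ^ a * real (Nd0 - Nd t \<omega>) ^ b) =
    (\<Sum>ku\<le>a. falling_factorial Nu0 ku * real (Stirling a ku) *
      (\<Sum>kd\<le>b. falling_factorial Nd0 kd * real (Stirling b kd) *
        (\<Sum>j\<le>ku + kd. (-1) ^ j * real ((ku + kd) choose j) * (1 - real j / real N) ^ t)))"
proof -
  let ?f = falling_factorial
  have "expectation (\<lambda>\<omega>. real (Nu0 - Nu t \<omega>) ^ a * real (Nd0 - Nd t \<omega>) ^ b) =
      expectation (\<lambda>\<omega>. \<Sum>ku\<le>a. \<Sum>kd\<le>b. real (Stirling a ku) * real (Stirling b kd) *
        (?f (Nu0 - Nu t \<omega>) ku * ?f (Nd0 - Nd t \<omega>) kd))"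
    by (simp add: power_eq_sum_Stirling sum_product mult_ac)
  also have "\<dots> = (\<Sum>ku\<le>a. \<Sum>kd\<le>b. real (Stirling a ku) * real (Stirling b kd) *
        expectation (\<lambda>\<omega>. ?f (Nu0 - Nu t \<omega>) ku * ?f (Nd0 - Nd t \<omega>) kd))"
    using integrable_state[OF assms, of "\<lambda>x y. ?f (Nu0 - x) _ * ?f (Nd0 - y) _" t]
    by (simp add: Bochner_Integration.integral_sum Bochner_Integration.integrable_sum)
  finally show ?thesis
    unfolding expectation_falling_factorial_departed[OF assms]
    by (simp add: sum_distrib_left mult_ac)
qed

end

section \<open>The moments of the log-price\<close>

theorem mainTheorem1:
  fixes M :: "'a measure"
    and N Nu0 Nd0 :: nat and u d p0 :: real
    and Nu Nd :: "nat \<Rightarrow> 'a \<Rightarrow> nat" and p :: "nat \<Rightarrow> 'a \<Rightarrow> real"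
    and n t :: nat
  assumes "1 \<le> N" and "Nu0 + Nd0 \<le> N"
    and "0 < d" and "d < 1" and "1 < u" and "0 < p0"
    and "bulls_and_bears M N Nu0 Nd0 u d p0 Nu Nd p"
    and "1 \<le> n"
  shows "integrable M (\<lambda>\<omega>. (ln (p t \<omega> / p 0 \<omega>)) ^ n) \<and>
    prob_space.expectation M (\<lambda>\<omega>. (ln (p t \<omega> / p 0 \<omega>)) ^ n) =
      (\<Sum>(nu, nd) \<in> {(nu, nd). nu + nd = n}.
        fact n / (fact nu * fact nd) * ln u ^ nu * ln d ^ nd *
        (\<Sum>ku = 0..nu. falling_factorial Nu0 ku * real (Stirling nu ku) *
          (\<Sum>kd = 0..nd. falling_factorial Nd0 kd * real (Stirling nd kd) *
            (\<Sum>j = 0..ku + kd. (-1) ^ j * real ((ku + kd) choose j) *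
              (1 - real j / real N) ^ t))))"
proof -
  interpret bulls_and_bears M N Nu0 Nd0 u d p0 Nu Nd p
    "history_algebra M (count_space UNIV \<Otimes>\<^sub>M count_space UNIV \<Otimes>\<^sub>M borel)
      (\<lambda>i \<omega>. (Nu i \<omega>, Nd i \<omega>, p i \<omega>))"
    by (rule assms(7))
  have N: "0 < N"
    using assms by simp
  let ?L = "\<lambda>\<omega>. (ln (p t \<omega> / p 0 \<omega>)) ^ n"
  let ?m = "\<lambda>k \<omega>. real (Nu0 - Nu t \<omega>) ^ k * real (Nd0 - Nd t \<omega>) ^ (n - k)"
  \<comment> \<open>The binomial coefficient is written with factorials to match the claimed
    formula.\<close>
  let ?c = "\<lambda>k. fact n / (fact k * fact (n - k)) * ln u ^ k * ln d ^ (n - k)"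
  have eq: "AE \<omega> in M. ?L \<omega> = (\<Sum>k\<le>n. ?c k * ?m k \<omega>)"
    using AE_price_eq[OF N, of t] initial
  proof eventually_elim
    case (elim \<omega>)
    \<comment> \<open>The positive \<open>p0\<close> cancels; positivity of \<open>u\<close> and
      \<open>d\<close> then makes the logarithm additive, and the binomial theorem gives the
      \<open>n\<close>-th power.\<close>
    have "ln (p t \<omega> / p 0 \<omega>) = ln (u ^ (Nu0 - Nu t \<omega>) * d ^ (Nd0 - Nd t \<omega>))"
      using elim assms by simp
    also have "\<dots> = real (Nu0 - Nu t \<omega>) * ln u + real (Nd0 - Nd t \<omega>) * ln d"
      using assms by (simp add: ln_mult ln_realpow)
    finally show ?case
      by (simp add: binomial_ring binomial_fact power_mult_distrib mult_ac)
  qed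
  have int: "integrable M (?m k)" for k
    using integrable_state[OF N, of "\<lambda>x y. real (Nu0 - x) ^ k * real (Nd0 - y) ^ (n - k)" t] .
  have "integrable M (\<lambda>\<omega>. \<Sum>k\<le>n. ?c k * ?m k \<omega>)"
    using int by (intro Bochner_Integration.integrable_sum integrable_mult_right)
  then have int_L: "integrable M ?L"
    by (rule integrable_cong_AE_imp) (use eq in \<open>auto elim: eventually_mono\<close>)
  have "expectation ?L = expectation (\<lambda>\<omega>. \<Sum>k\<le>n. ?c k * ?m k \<omega>)"
    by (rule integral_cong_AE) (use eq in auto)
  then have "expectation ?L = (\<Sum>k\<le>n. ?c k * expectation (?m k))"
    using int by (simp add: Bochner_Integration.integral_sum Bochner_Integration.integrable_sum)
  also have "\<dots> = (\<Sum>(nu, nd) \<in> {(nu, nd). nu + nd = n}.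
        fact n / (fact nu * fact nd) * ln u ^ nu * ln d ^ nd *
        expectation (\<lambda>\<omega>. real (Nu0 - Nu t \<omega>) ^ nu * real (Nd0 - Nd t \<omega>) ^ nd))"
    by (rule sum.reindex_bij_witness[of _ fst "\<lambda>k. (k, n - k)"]) auto
  finally show ?thesis
    using int_L unfolding expectation_power_departed[OF N] atLeast0AtMost by simp
qed

end
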